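(* Let $n\ge2$, $m\in\mathbb{Z}$, $\omega=2\pi m/n$, $g=\gcd(m,n)$, $L=n/g$, and let $0\le\beta<\infty$. Let $A^\star$ be the $n\times n$ consensus attention matrix $$A^\star_{ij}=\frac{e^{\beta\cos(\omega(i-j))}}{\sum_{k=0}^{n-1}e^{\beta\cos(\omega(i-k))}},\qquad i,j=0,\dots,n-1.$$ Then $A^\star$ is symmetric, doubly stochastic, and circulant. Its Fourier eigenvalues (the eigenvalue $\lambda_q$ corresponding to the eigenvector $(e^{2\pi \mathrm{i}qj/n})_{j=0}^{n-1}$) are $$\lambda_q=\frac{\displaystyle\sum_{k\in\mathbb{Z},\ mk\equiv q\ (\mathrm{mod}\ n)}I_k(\beta)}{\displaystyle\sum_{k\in\mathbb{Z},\ mk\equiv0\ (\mathrm{mod}\ n)}I_k(\beta)},\qquad q=0,\ldots,n-1.$$ If $g\nmid q$, then $\lambda_q=0$. For $\beta>0$, exactly $L$ of the eigenvalues $\lambda_0,\dots,\lambda_{n-1}$ are positive and $n-L$ vanish. At $\beta=0$, the spectrum is $(1,0,\ldots,0)$.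
   Context: $I_k$ denotes the modified Bessel function of the first kind of integer order $k$. The convention $\gcd(0,n)=n$ is used. $A^\star$ is the attention matrix, at a consensus state, of single-frequency rotary self-attention on $\mathbb{S}^1$ with tokens at integer positions $p_j=j$, $j=0,\dots,n-1$. *)

theory Defs
  imports
    "HOL-Analysis.Analysis"
    "HOL-Number_Theory.Cong"
    "Jordan_Normal_Form.Char_Poly"
begin

text \<open>
  Modified Bessel function of the first kind of integer order, by its standard power series
  \<open>I\<^sub>k(x) = \<Sum>\<^sub>j (x/2)^(2j+k) / (j! \<Gamma>(j+k+1))\<close>.
  For \<open>k < 0\<close> the terms with \<open>j + k + 1 \<le> 0\<close> vanish because \<^const>\<open>rGamma\<close> (the entire function
  \<open>1/\<Gamma>\<close>) is zero there; all remaining exponents \<open>2j + k\<close> are nonnegative, so the series is also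
  correct at \<open>x = 0\<close> (where \<open>0 powi 0 = 1\<close>).
\<close>
definition bessel_I :: "int \<Rightarrow> real \<Rightarrow> real" where
  "bessel_I k x = (\<Sum>j. (x / 2) powi (2 * int j + k) * rGamma (of_int (int j + k + 1)) / fact j)"

definition consensus_attention :: "nat \<Rightarrow> real \<Rightarrow> real \<Rightarrow> real mat" where
  "consensus_attention n \<omega> \<beta> = Matrix.mat n n (\<lambda>(i, j).
     exp (\<beta> * cos (\<omega> * (real i - real j))) /
     (\<Sum>k = 0..<n. exp (\<beta> * cos (\<omega> * (real i - real k)))))"

definition symmetric_matrix :: "'a mat \<Rightarrow> bool" where
  "symmetric_matrix A \<longleftrightarrow> transpose_mat A = A"

definition doubly_stochastic :: "real mat \<Rightarrow> bool" where
  "doubly_stochastic A \<longleftrightarrow> square_mat A \<and>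
     (\<forall>i < dim_row A. \<forall>j < dim_col A. A $$ (i, j) \<ge> 0) \<and>
     (\<forall>i < dim_row A. (\<Sum>j = 0..<dim_col A. A $$ (i, j)) = 1) \<and>
     (\<forall>j < dim_col A. (\<Sum>i = 0..<dim_row A. A $$ (i, j)) = 1)"

definition circulant :: "'a mat \<Rightarrow> bool" where
  "circulant A \<longleftrightarrow> square_mat A \<and>
     (\<exists>c :: int \<Rightarrow> 'a. \<forall>i < dim_row A. \<forall>j < dim_col A.
        A $$ (i, j) = c ((int i - int j) mod int (dim_row A)))"

definition fourier_vec :: "nat \<Rightarrow> nat \<Rightarrow> complex Matrix.vec" where
  "fourier_vec n q = Matrix.vec n (\<lambda>j. exp (2 * of_real pi * \<i> * of_nat q * of_nat j / of_nat n))"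

end

theory Submission
  imports Defs
begin

text \<open>
  The entries of the attention matrix depend only on \<open>i - j\<close> modulo \<open>n\<close>, through the even function
  \<open>w(a) = exp (\<beta> cos (2\<pi>ma/n))\<close>. Hence the matrix is convolution on the cyclic group of order \<open>n\<close>
  by \<open>w\<close>, normalised to total mass \<open>1\<close>: symmetry, double stochasticity and circulance follow, the
  characters of the group are eigenvectors, and the eigenvalues are the finite Fourier coefficients
  of \<open>w\<close> divided by \<open>\<Sum>\<^sub>d w(d)\<close>.
  
  The Bessel functions enter through the Fourier series
  \<open>exp (x cos \<theta>) = \<Sum>\<^sub>k I\<^sub>k(x) cis (k\<theta>)\<close> (\<open>bessel_I_fourier_series\<close>). At \<open>\<theta> = 2\<pi>md/n\<close>, averaging
  over \<open>d\<close> against a character is a roots-of-unity filter that keeps exactly the \<open>k\<close> with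
  \<open>mk \<equiv> q (mod n)\<close> (\<open>bessel_I_residue_class_has_sum\<close>). So the finite Fourier coefficient of \<open>w\<close> at
  \<open>q\<close> is \<open>n\<close> times the sum of \<open>I\<^sub>k(\<beta>)\<close> over this residue class, and the factor \<open>n\<close> cancels in the
  quotient.
  
  The signs are then arithmetic. The congruence \<open>mk \<equiv> q (mod n)\<close> is solvable precisely when
  \<open>g = gcd m n\<close> divides \<open>q\<close>. If it is not solvable, the sum is empty; if it is and \<open>\<beta> > 0\<close>, the sum is
  positive because every \<open>I\<^sub>k(\<beta>)\<close> is. There are \<open>n / g\<close> multiples of \<open>g\<close> below \<open>n\<close>. At \<open>\<beta> = 0\<close> only
  \<open>I\<^sub>0 = 1\<close> survives, and \<open>k = 0\<close> lies in the class of \<open>q < n\<close> only for \<open>q = 0\<close>.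
\<close>

section \<open>The generating function of the Bessel functions\<close>

definition bessel_I_term :: "real \<Rightarrow> int \<Rightarrow> nat \<Rightarrow> real" where
  "bessel_I_term x k j = (x / 2) powi (2 * int j + k) * rGamma (of_int (int j + k + 1)) / fact j"

text \<open>
  Away from the poles of \<open>\<Gamma>\<close>, the exponent \<open>2j + k\<close> splits as \<open>(j + k) + j\<close> with both parts
  nonnegative. The term is thus a product of two terms of exponential series, which is what links
  the Bessel functions to \<open>exp u * exp v\<close>.
\<close>
lemma bessel_I_term_eq:
  "bessel_I_term x k j =
     (if int j + k < 0 then 0
      else (x / 2) ^ nat (int j + k) / fact (nat (int j + k)) * ((x / 2) ^ j / fact j))"
proof (cases "int j + k < 0")
  case True
  then have "(of_int (int j + k + 1) :: real) \<in> \<int>\<^sub>\<le>\<^sub>0"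
    by (intro nonpos_Ints_of_int) auto
  with True show ?thesis
    by (simp only: bessel_I_term_def rGamma_eq_zero_iff[THEN iffD2]) simp
next
  case False
  then have arg: "(of_int (int j + k + 1) :: real) = 1 + of_nat (nat (int j + k))"
    by simp
  have "2 * int j + k = int (nat (int j + k) + j)"
    using False by simp
  then have "(x / 2) powi (2 * int j + k) = (x / 2) ^ nat (int j + k) * (x / 2) ^ j"
    by (simp only: power_int_of_nat power_add)
  then show ?thesis
    using False unfolding bessel_I_term_def arg rGamma_inverse_Gamma Gamma_fact
    by (simp only: if_False divide_inverse mult_ac)
qed

text \<open>
  Both exponential series converge absolutely, so their product may be summed over all pairs in any
  order. This unordered form permits regrouping along the diagonals \<open>a - b = k\<close>.
\<close>
lemma exp_times_exp_has_sum:
  fixes u v :: complex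
  shows "((\<lambda>(a, b). u ^ a / fact a * (v ^ b / fact b)) has_sum exp (u + v)) (UNIV \<times> UNIV)"
proof -
  have exp_norm: "summable (\<lambda>a. norm (w ^ a / fact a))" for w :: complex
    using summable_norm_exp[of w] by (simp add: norm_mult norm_power norm_inverse divide_inverse_commute)
  then have exp_abs: "(\<lambda>a. norm (w ^ a / fact a)) summable_on UNIV" for w :: complex
    by (subst summable_on_UNIV_nonneg_real_iff) auto
  have exp_sum: "((\<lambda>a. w ^ a / fact a) has_sum exp w) UNIV" for w :: complex
    using exp_converges[of w]
    by (intro norm_summable_imp_has_sum exp_norm) (simp add: scaleR_conv_of_real divide_inverse mult.commute)
  have "(\<lambda>p. norm ((\<lambda>(a, b). u ^ a / fact a * (v ^ b / fact b)) p)) summable_on (UNIV \<times> UNIV)"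
  proof (subst Infinite_Sum.abs_summable_on_Sigma_iff, intro conjI ballI)
    show "(\<lambda>b. norm (case (a, b) of (a, b) \<Rightarrow> u ^ a / fact a * (v ^ b / fact b))) summable_on UNIV" for a
      unfolding prod.case norm_mult by (rule summable_on_cmult_right) (rule exp_abs)
    have "(\<lambda>a. norm (u ^ a / fact a) * (\<Sum>\<^sub>\<infinity>b. norm (v ^ b / fact b))) summable_on UNIV"
      by (rule summable_on_cmult_left) (rule exp_abs)
    then show "(\<lambda>a. norm (\<Sum>\<^sub>\<infinity>b. norm (case (a, b) of (a, b) \<Rightarrow> u ^ a / fact a * (v ^ b / fact b))))
        summable_on UNIV"
      unfolding prod.case norm_mult infsum_cmult_right' by (simp add: abs_mult infsum_nonneg)
  qed
  then have "(\<lambda>(a, b). u ^ a / fact a * (v ^ b / fact b)) summable_on (UNIV \<times> UNIV)"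
    by (rule Infinite_Sum.abs_summable_summable)
  moreover have "((\<lambda>b. u ^ a / fact a * (v ^ b / fact b)) has_sum (u ^ a / fact a * exp v)) UNIV" for a
    by (rule has_sum_cmult_right) (rule exp_sum)
  moreover have "((\<lambda>a. u ^ a / fact a * exp v) has_sum exp (u + v)) UNIV"
    unfolding exp_add by (rule has_sum_cmult_left) (rule exp_sum)
  ultimately show ?thesis
    by (intro has_sum_SigmaI[where g = "\<lambda>a. u ^ a / fact a * exp v"]) auto
qed

text \<open>
  This is the product of the series of \<open>exp (xt/2)\<close> and \<open>exp (x/(2t))\<close>, reindexed by \<open>k = a - b\<close>
  and \<open>j = b\<close>. Pairs \<open>(k, j)\<close> with \<open>j + k < 0\<close> correspond to no \<open>a\<close>; the zeros of \<open>1/\<Gamma>\<close> make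
  their terms vanish, so the index set can be the full product.
\<close>
lemma bessel_I_term_double_has_sum:
  fixes t :: complex and x :: real
  assumes "t \<noteq> 0"
  shows "((\<lambda>(k, j). of_real (bessel_I_term x k j) * t powi k)
            has_sum exp (of_real x / 2 * (t + inverse t))) (UNIV \<times> UNIV)"
proof -
  let ?f = "\<lambda>(k, j). of_real (bessel_I_term x k j) * t powi k"
  let ?g = "\<lambda>(a, b). (of_real x / 2 * t) ^ a / fact a * ((of_real x / 2 * inverse t) ^ b / fact b)"
  have pw: "t powi k = t ^ nat (int j + k) * inverse t ^ j" if "\<not> int j + k < 0" for k j
  proof -
    have "t powi k = t powi (int (nat (int j + k)) - int j)"
      using that by simp
    also have "\<dots> = t ^ nat (int j + k) * inverse t ^ j"
      using assms by (simp only: power_int_diff power_int_of_nat simp_thms divide_inverse power_inverse)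
    finally show ?thesis .
  qed
  have "(?g has_sum exp (of_real x / 2 * t + of_real x / 2 * inverse t)) (UNIV \<times> UNIV)"
    by (rule exp_times_exp_has_sum)
  then have "(?g has_sum exp (of_real x / 2 * (t + inverse t))) (UNIV \<times> UNIV)"
    by (simp only: distrib_left)
  also have "?this \<longleftrightarrow> (?f has_sum exp (of_real x / 2 * (t + inverse t))) {(k, j). \<not> int j + k < 0}"
  proof (rule has_sum_reindex_bij_witness[where j = "\<lambda>(a, b). (int a - int b, b)"
        and i = "\<lambda>(k, j). (nat (int j + k), j)"])
    fix p :: "nat \<times> nat"
    show "?f (case p of (a, b) \<Rightarrow> (int a - int b, b)) = ?g p"
      using pw[of "snd p" "int (fst p) - int (snd p)"]
      by (simp add: bessel_I_term_eq split_beta power_mult_distrib power_divide)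
  qed auto
  also have "\<dots> \<longleftrightarrow> (?f has_sum exp (of_real x / 2 * (t + inverse t))) (UNIV \<times> UNIV)"
    by (rule has_sum_cong_neutral) (auto simp: bessel_I_term_eq)
  finally show ?thesis .
qed

text \<open>
  At \<open>t = 1\<close> the double sum shows that the series for a fixed order is unconditionally summable;
  only then does the series in the definition of \<open>bessel_I\<close> yield a meaningful value.
\<close>
lemma bessel_I_term_has_sum: "(bessel_I_term x k has_sum bessel_I k x) UNIV"
proof -
  have "(\<lambda>(k, j). of_real (bessel_I_term x k j) * (1::complex) powi k) summable_on (UNIV \<times> UNIV)"
    using bessel_I_term_double_has_sum[of 1 x] by (auto simp: summable_on_def)
  then have "(\<lambda>j. of_real (bessel_I_term x k j) * (1::complex) powi k) summable_on UNIV"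
    by (rule summable_on_SigmaD1) simp
  then have "(\<lambda>j. Re (of_real (bessel_I_term x k j) * (1::complex) powi k)) summable_on UNIV"
    by (rule summable_on_bounded_linear[OF bounded_linear_Re])
  then have "(bessel_I_term x k has_sum infsum (bessel_I_term x k) UNIV) UNIV"
    by (simp add: has_sum_infsum)
  moreover from has_sum_imp_sums[OF this]
  have "infsum (bessel_I_term x k) UNIV = bessel_I k x"
    by (simp only: sums_iff bessel_I_def bessel_I_term_def[abs_def])
  ultimately show ?thesis by simp
qed

theorem bessel_I_generating_function:
  fixes t :: complex and x :: real
  assumes "t \<noteq> 0"
  shows "((\<lambda>k. of_real (bessel_I k x) * t powi k)
            has_sum exp (of_real x / 2 * (t + inverse t))) UNIV"
proof (rule has_sum_SigmaD[OF bessel_I_term_double_has_sum[OF assms]])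
  fix k
  show "((\<lambda>j. case (k, j) of (k, j) \<Rightarrow> of_real (bessel_I_term x k j) * t powi k)
          has_sum of_real (bessel_I k x) * t powi k) UNIV"
    unfolding prod.case by (intro has_sum_cmult_left has_sum_of_real bessel_I_term_has_sum)
qed

text \<open>
  On the unit circle \<open>t + 1/t = 2 cos \<theta>\<close>, so the generating function becomes a Fourier series.
\<close>
corollary bessel_I_fourier_series:
  "((\<lambda>k. of_real (bessel_I k x) * cis (of_int k * \<theta>)) has_sum of_real (exp (x * cos \<theta>))) UNIV"
proof -
  have "cis \<theta> + inverse (cis \<theta>) = of_real (2 * cos \<theta>)"
    by (simp add: complex_eq_iff)
  then have "exp (of_real x / 2 * (cis \<theta> + inverse (cis \<theta>))) = of_real (exp (x * cos \<theta>))"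
    by (simp flip: exp_of_real)
  with bessel_I_generating_function[of "cis \<theta>" x] show ?thesis
    by (simp add: cis_power_int)
qed

text \<open>
  All terms of the series are nonnegative, and the term with \<open>j = max 0 (-k)\<close> lies in the range where
  \<open>1/\<Gamma>\<close> does not vanish.
\<close>
lemma bessel_I_pos:
  assumes "x > 0"
  shows "bessel_I k x > 0"
proof -
  have nonneg: "bessel_I_term x k j \<ge> 0" for j
    using assms by (simp add: bessel_I_term_eq)
  have "bessel_I_term x k (nat (- k)) > 0"
    using assms by (simp add: bessel_I_term_eq)
  then show ?thesis
    using has_sum_imp_sums[OF bessel_I_term_has_sum[of x k]] nonneg
    by (metis sums_iff suminf_pos2)
qed

lemma bessel_I_at_0: "bessel_I k 0 = (if k = 0 then 1 else 0)"
proof -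
  have term0: "bessel_I_term 0 k j = (if j = 0 \<and> k = 0 then 1 else 0)" for j
    by (auto simp: bessel_I_term_eq power_0_left)
  have "(\<lambda>j. if j = 0 then if k = 0 then 1 else 0 else 0) sums (if k = 0 then 1 else (0::real))"
    by (rule sums_single)
  also have "(\<lambda>j. if j = 0 then if k = 0 then 1 else 0 else 0) = bessel_I_term 0 k"
    by (auto simp: term0 fun_eq_iff)
  finally show ?thesis
    using has_sum_imp_sums[OF bessel_I_term_has_sum[of 0 k]] sums_unique2 by blast
qed

section \<open>Bessel sums over residue classes\<close>

text \<open>
  Orthogonality of characters: the sum is geometric with an \<open>n\<close>-th root of unity as ratio, and the
  ratio is \<open>1\<close> exactly when \<open>n\<close> divides \<open>l\<close>.
\<close>
lemma sum_cis_eq_if_dvd: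
  assumes "n > 0"
  shows "(\<Sum>d<n. cis (2 * pi * of_int l * real d / real n)) = (if int n dvd l then of_nat n else 0)"
proof -
  define z where "z = cis (2 * pi * of_int l / real n)"
  have "(\<Sum>d<n. cis (2 * pi * of_int l * real d / real n)) = (\<Sum>d<n. z ^ d)"
    by (intro sum.cong refl) (simp add: z_def Complex.DeMoivre mult_ac)
  also have "\<dots> = (if int n dvd l then of_nat n else 0)"
  proof (cases "int n dvd l")
    case True
    then obtain c where "l = int n * c" ..
    then have "2 * pi * of_int l / real n = 2 * pi * of_int c"
      using assms by simp
    then have "z = 1"
      unfolding z_def by (simp only: cis_multiple_2pi Ints_of_int)
    with True show ?thesis by simp
  next
    case False
    have "z \<noteq> 1"
    proof
      assume "z = 1"
      then have "cos (2 * pi * of_int l / real n) = 1"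
        by (simp add: z_def complex_eq_iff)
      then obtain c :: int where "2 * pi * of_int l / real n = of_int c * 2 * pi"
        unfolding cos_one_2pi_int ..
      then have "real_of_int l = real_of_int (c * int n)"
        using assms by (simp add: field_simps)
      then have "l = c * int n"
        by (simp only: of_int_eq_iff)
      with False show False by simp
    qed
    moreover have "z ^ n = 1"
      unfolding z_def Complex.DeMoivre using assms by simp
    ultimately show ?thesis
      using False by (simp add: geometric_sum)
  qed
  finally show ?thesis .
qed

lemma has_sum_sum_lessThan:
  fixes f :: "nat \<Rightarrow> 'a \<Rightarrow> 'b :: topological_comm_monoid_add"
  assumes "\<And>d. d < n \<Longrightarrow> (f d has_sum s d) A"
  shows "((\<lambda>k. \<Sum>d<n. f d k) has_sum (\<Sum>d<n. s d)) A"
  using assms by (induction n) (auto intro: has_sum_add)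

text \<open>
  The roots-of-unity filter: averaging the Fourier series at the \<open>n\<close> angles \<open>2\<pi>md/n\<close> against the
  character of index \<open>q\<close> multiplies \<open>I\<^sub>k\<close> by the average of \<open>cis (2\<pi>(mk - q)d/n)\<close> over \<open>d\<close>, which is
  the indicator of \<open>mk \<equiv> q\<close>.
\<close>
lemma bessel_I_residue_class_has_sum:
  assumes "n > 0"
  shows "((\<lambda>k. of_real (bessel_I k x)) has_sum
           (\<Sum>d<n. of_real (exp (x * cos (2 * pi * of_int m / real n * real d)))
              * cis (- (2 * pi * of_int q * real d / real n))) / of_nat n)
         {k. [m * k = q] (mod int n)}"
proof -
  let ?\<theta> = "\<lambda>d. 2 * pi * of_int m / real n * real d"
  let ?\<phi> = "\<lambda>d. - (2 * pi * of_int q * real d / real n)"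
  let ?S = "\<Sum>d<n. of_real (exp (x * cos (?\<theta> d))) * cis (?\<phi> d)"
  have filter: "(\<Sum>d<n. of_real (bessel_I k x) * cis (of_int k * ?\<theta> d) * cis (?\<phi> d)) / of_nat n
      = (if [m * k = q] (mod int n) then of_real (bessel_I k x) else 0)" for k
  proof -
    have "(\<Sum>d<n. of_real (bessel_I k x) * cis (of_int k * ?\<theta> d) * cis (?\<phi> d))
        = of_real (bessel_I k x) * (\<Sum>d<n. cis (2 * pi * of_int (m * k - q) * real d / real n))"
      unfolding sum_distrib_left mult.assoc cis_mult
      by (intro sum.cong refl arg_cong2[of _ _ _ _ "(*)"] arg_cong[of _ _ cis])
        (use assms in \<open>simp add: field_simps\<close>)
    then show ?thesis
      using assms by (simp only: sum_cis_eq_if_dvd) (simp add: cong_iff_dvd_diff)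
  qed
  have "((\<lambda>k. \<Sum>d<n. of_real (bessel_I k x) * cis (of_int k * ?\<theta> d) * cis (?\<phi> d)) has_sum ?S) UNIV"
    by (intro has_sum_sum_lessThan has_sum_cmult_left bessel_I_fourier_series)
  then have "((\<lambda>k. (\<Sum>d<n. of_real (bessel_I k x) * cis (of_int k * ?\<theta> d) * cis (?\<phi> d)) / of_nat n)
      has_sum ?S / of_nat n) UNIV"
    unfolding divide_inverse by (rule has_sum_cmult_left)
  then have "((\<lambda>k. if [m * k = q] (mod int n) then of_real (bessel_I k x) else 0)
      has_sum ?S / of_nat n) UNIV"
    unfolding filter .
  also have "?this \<longleftrightarrow> ?thesis"
    by (rule has_sum_cong_neutral) auto
  finally show ?thesis .
qed

lemma bessel_I_residue_class_summable:
  assumes "n > 0"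
  shows "(\<lambda>k. bessel_I k x) summable_on {k. [m * k = q] (mod int n)}"
proof -
  have "(\<lambda>k. complex_of_real (bessel_I k x)) summable_on {k. [m * k = q] (mod int n)}"
    using bessel_I_residue_class_has_sum[OF assms] by (auto simp: summable_on_def)
  then have "(\<lambda>k. Re (complex_of_real (bessel_I k x))) summable_on {k. [m * k = q] (mod int n)}"
    by (rule summable_on_bounded_linear[OF bounded_linear_Re])
  then show ?thesis by simp
qed

text \<open>
  The right-hand side is the normalised finite Fourier coefficient of the attention weights at \<open>q\<close>;
  this identity turns eigenvalues into Bessel sums.
\<close>
lemma bessel_I_residue_class_infsum:
  assumes "n > 0"
  shows "of_real (\<Sum>\<^sub>\<infinity>k \<in> {k. [m * k = q] (mod int n)}. bessel_I k x) =
           (\<Sum>d<n. of_real (exp (x * cos (2 * pi * of_int m / real n * real d)))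
              * cis (- (2 * pi * of_int q * real d / real n))) / of_nat n"
  by (rule has_sum_unique[OF has_sum_of_real[OF has_sum_infsum]])
    (rule bessel_I_residue_class_summable bessel_I_residue_class_has_sum, fact)+

lemma bessel_I_residue_class_infsum_0:
  assumes "n > 0"
  shows "(\<Sum>\<^sub>\<infinity>k \<in> {k. [m * k = 0] (mod int n)}. bessel_I k x) =
           (\<Sum>d<n. exp (x * cos (2 * pi * of_int m / real n * real d))) / real n"
proof -
  have "complex_of_real (\<Sum>\<^sub>\<infinity>k \<in> {k. [m * k = 0] (mod int n)}. bessel_I k x) =
      of_real ((\<Sum>d<n. exp (x * cos (2 * pi * of_int m / real n * real d))) / real n)"
    using bessel_I_residue_class_infsum[OF assms, of x m 0] by simp
  then show ?thesis
    by (simp only: of_real_eq_iff)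
qed

text \<open>
  Divisibility makes the congruence solvable, and any one solution \<open>k\<close> already contributes
  \<open>I\<^sub>k(x) > 0\<close> to a sum of positive terms.
\<close>
lemma bessel_I_residue_class_pos:
  assumes "n > 0" "x > 0" and "gcd m (int n) dvd q"
  shows "(\<Sum>\<^sub>\<infinity>k \<in> {k. [m * k = q] (mod int n)}. bessel_I k x) > 0"
proof -
  obtain k where k: "[m * k = q] (mod int n)"
    using cong_solve_dvd_int[OF assms(3)] by blast
  have "0 < bessel_I k x"
    using assms by (simp add: bessel_I_pos)
  also have "bessel_I k x = (\<Sum>\<^sub>\<infinity>k \<in> {k}. bessel_I k x)"
    by simp
  also have "\<dots> \<le> (\<Sum>\<^sub>\<infinity>k \<in> {k. [m * k = q] (mod int n)}. bessel_I k x)"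
    using k bessel_I_residue_class_summable[OF assms(1)] bessel_I_pos[OF assms(2)]
    by (intro infsum_mono_neutral) (auto simp: less_imp_le)
  finally show ?thesis .
qed

text \<open>
  Modulo \<open>gcd m n\<close> the left-hand side of the congruence is \<open>0\<close>.
\<close>
lemma residue_class_empty:
  assumes "\<not> gcd m (int n) dvd q"
  shows "{k. [m * k = q] (mod int n)} = {}"
proof -
  have "gcd m (int n) dvd q" if "[m * k = q] (mod int n)" for k
  proof -
    have "[m * k = q] (mod gcd m (int n))"
      using that by (rule cong_dvd_modulus) simp
    then show ?thesis
      using cong_dvd_iff dvd_mult2 gcd_dvd1 by blast
  qed
  with assms show ?thesis by blast
qed

lemma bessel_I_residue_class_at_0:
  "(\<Sum>\<^sub>\<infinity>k \<in> {k. [m * k = q] (mod int n)}. bessel_I k 0) = (if int n dvd q then 1 else 0)"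
proof -
  have "(\<Sum>\<^sub>\<infinity>k \<in> {k. [m * k = q] (mod int n)}. bessel_I k 0)
      = (\<Sum>\<^sub>\<infinity>k \<in> {k. k = 0 \<and> [m * k = q] (mod int n)}. bessel_I k 0)"
    by (rule infsum_cong_neutral) (auto simp: bessel_I_at_0)
  also have "{k. k = 0 \<and> [m * k = q] (mod int n)} = (if int n dvd q then {0} else {})"
    by (auto simp: cong_0_iff cong_sym_eq[of 0])
  finally show ?thesis
    by (simp add: bessel_I_at_0)
qed

section \<open>Convolution on the cyclic group\<close>

text \<open>
  The reflection \<open>j \<mapsto> i - j\<close> is an involution of the residues modulo \<open>n\<close>. This gives both the row sums
  (with \<open>h\<close> the weight) and the eigenvector equation (with \<open>h\<close> the weight times a character).
\<close>
lemma sum_periodic_reflect: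
  fixes h :: "int \<Rightarrow> 'a :: comm_monoid_add"
  assumes "n > 0" and "\<And>a. h (a mod int n) = h a"
  shows "(\<Sum>j<n. h (i - int j)) = (\<Sum>d<n. h (int d))"
proof (rule sum.reindex_bij_witness[where i = "\<lambda>j. nat ((i - int j) mod int n)"
      and j = "\<lambda>j. nat ((i - int j) mod int n)"])
  fix j assume "j \<in> {..<n}"
  then have "(i - (i - int j) mod int n) mod int n = int j"
    by (simp add: mod_diff_right_eq)
  then show "nat ((i - int (nat ((i - int j) mod int n))) mod int n) = j"
    and "nat ((i - int (nat ((i - int j) mod int n))) mod int n) = j"
    using assms(1) by simp_all
  show "nat ((i - int j) mod int n) \<in> {..<n}" "nat ((i - int j) mod int n) \<in> {..<n}"
    using assms(1) by (auto simp: nat_less_iff)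
  show "h (int (nat ((i - int j) mod int n))) = h (i - int j)"
    using assms by simp
qed

definition attention_weight :: "real \<Rightarrow> nat \<Rightarrow> int \<Rightarrow> int \<Rightarrow> real" where
  "attention_weight \<beta> n m a = exp (\<beta> * cos (2 * pi * of_int m / real n * of_int a))"

lemma cis_periodic:
  assumes "n > 0"
  shows "cis (2 * pi * of_int q * of_int (a mod int n) / real n) = cis (2 * pi * of_int q * of_int a / real n)"
proof -
  define c where "c = q * (a div int n)"
  have "real_of_int a = of_int (a mod int n) + real n * of_int (a div int n)"
    by (metis mod_mult_div_eq of_int_add of_int_mult of_int_of_nat_eq)
  then have "2 * pi * of_int q * of_int a / real n
      = 2 * pi * of_int q * of_int (a mod int n) / real n + 2 * pi * of_int c"
    using assms by (simp add: c_def field_simps)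
  then show ?thesis
    by (simp only: cis_mult[symmetric] cis_multiple_2pi Ints_of_int mult_1_right)
qed

text \<open>
  Periodicity depends on the frequency being a multiple of \<open>2\<pi>/n\<close>; the cosine is the real part of the
  character of index \<open>m\<close>.
\<close>
lemma attention_weight_periodic:
  assumes "n > 0"
  shows "attention_weight \<beta> n m (a mod int n) = attention_weight \<beta> n m a"
  using arg_cong[OF cis_periodic[OF assms, of m a], of Re]
  by (simp add: attention_weight_def)

lemma attention_weight_minus: "attention_weight \<beta> n m (- a) = attention_weight \<beta> n m a"
  by (simp add: attention_weight_def)

text \<open>
  The normalising sum of a row is the same for all rows, which makes the matrix a convolution.
\<close>
lemma consensus_attention_index:
  assumes "i < n" "j < n"
  shows "consensus_attention n (2 * pi * of_int m / real n) \<beta> $$ (i, j) =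
    attention_weight \<beta> n m (int i - int j) / (\<Sum>d<n. attention_weight \<beta> n m (int d))"
proof -
  have "(\<Sum>k = 0..<n. exp (\<beta> * cos (2 * pi * of_int m / real n * (real i - real k))))
      = (\<Sum>k<n. attention_weight \<beta> n m (int i - int k))"
    by (simp add: attention_weight_def lessThan_atLeast0)
  also have "\<dots> = (\<Sum>d<n. attention_weight \<beta> n m (int d))"
    using assms by (intro sum_periodic_reflect attention_weight_periodic) auto
  finally show ?thesis
    using assms by (simp add: consensus_attention_def attention_weight_def)
qed

lemma attention_weight_sum_pos:
  "n > 0 \<Longrightarrow> (\<Sum>d<n. attention_weight \<beta> n m (int d)) > 0"
  by (intro sum_pos) (auto simp: attention_weight_def)

lemma consensus_attention_dim [simp]:
  "dim_row (consensus_attention n \<omega> \<beta>) = n" "dim_col (consensus_attention n \<omega> \<beta>) = n"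
  by (simp_all add: consensus_attention_def)

lemma consensus_attention_symmetric:
  "symmetric_matrix (consensus_attention n (2 * pi * of_int m / real n) \<beta>)"
  unfolding symmetric_matrix_def
  by (rule eq_matI)
    (use attention_weight_minus[of \<beta> n m] in
      \<open>auto simp: consensus_attention_index, metis minus_diff_eq\<close>)

lemma consensus_attention_row_sum:
  assumes "i < n"
  shows "(\<Sum>j = 0..<n. consensus_attention n (2 * pi * of_int m / real n) \<beta> $$ (i, j)) = 1"
proof -
  let ?W = "\<Sum>d<n. attention_weight \<beta> n m (int d)"
  have "(\<Sum>j = 0..<n. consensus_attention n (2 * pi * of_int m / real n) \<beta> $$ (i, j))
      = (\<Sum>j<n. attention_weight \<beta> n m (int i - int j)) / ?W"
    using assms by (simp add: consensus_attention_index lessThan_atLeast0 sum_divide_distrib)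
  also have "(\<Sum>j<n. attention_weight \<beta> n m (int i - int j)) = ?W"
    using assms by (intro sum_periodic_reflect attention_weight_periodic) auto
  finally show ?thesis
    using attention_weight_sum_pos[of n \<beta> m] assms by simp
qed

lemma consensus_attention_doubly_stochastic:
  "doubly_stochastic (consensus_attention n (2 * pi * of_int m / real n) \<beta>)"
proof -
  let ?A = "consensus_attention n (2 * pi * of_int m / real n) \<beta>"
  have "?A $$ (i, j) \<ge> 0" if "i < n" "j < n" for i j
    using that attention_weight_sum_pos[of n \<beta> m]
    by (simp add: consensus_attention_index) (simp add: attention_weight_def)
  moreover have "(\<Sum>i = 0..<n. ?A $$ (i, j)) = 1" if "j < n" for j
  proof -
    have "?A $$ (i, j) = ?A $$ (j, i)" if "i < n" for i
      using consensus_attention_symmetric[of n m \<beta>] \<open>i < n\<close> \<open>j < n\<close>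
      unfolding symmetric_matrix_def by (metis consensus_attention_dim index_transpose_mat(1))
    then show ?thesis
      using consensus_attention_row_sum[OF \<open>j < n\<close>] by simp
  qed
  ultimately show ?thesis
    by (simp add: doubly_stochastic_def consensus_attention_row_sum)
qed

lemma consensus_attention_circulant:
  "circulant (consensus_attention n (2 * pi * of_int m / real n) \<beta>)"
  unfolding circulant_def
  by (intro conjI exI[of _ "\<lambda>a. attention_weight \<beta> n m a / (\<Sum>d<n. attention_weight \<beta> n m (int d))"])
    (auto simp: consensus_attention_index attention_weight_periodic)

lemma fourier_vec_index:
  "j < n \<Longrightarrow> fourier_vec n q $ j = cis (2 * pi * of_int (int q) * of_int (int j) / real n)"
  by (simp add: fourier_vec_def cis_conv_exp mult_ac)

text \<open>
  Since \<open>e(j) = e(i) / e(i - j)\<close> for the character \<open>e\<close> of index \<open>q\<close>, the \<open>i\<close>-th entry of the product is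
  \<open>e(i)\<close> times a sum over \<open>i - j\<close> of a periodic function, and that sum does not depend on \<open>i\<close>.
\<close>
lemma consensus_attention_fourier_eigenvector:
  fixes n q :: nat and m :: int and \<beta> :: real
  assumes "n > 0"
  defines "w \<equiv> attention_weight \<beta> n m"
  shows "eigenvector (map_mat complex_of_real (consensus_attention n (2 * pi * of_int m / real n) \<beta>))
    (fourier_vec n q)
    ((\<Sum>d<n. of_real (w (int d)) * cis (- (2 * pi * of_int (int q) * of_int (int d) / real n)))
       / of_real (\<Sum>d<n. w (int d)))"
proof -
  let ?A = "map_mat complex_of_real (consensus_attention n (2 * pi * of_int m / real n) \<beta>)"
  let ?e = "\<lambda>a. cis (2 * pi * of_int (int q) * of_int a / real n)"
  let ?h = "\<lambda>a. of_real (w a) * inverse (?e a)"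
  let ?W = "complex_of_real (\<Sum>d<n. w (int d))"
  have dim: "dim_vec (fourier_vec n q) = n"
    by (simp add: fourier_vec_def)
  have "?A *\<^sub>v fourier_vec n q = ((\<Sum>d<n. ?h (int d)) / ?W) \<cdot>\<^sub>v fourier_vec n q"
  proof (rule eq_vecI)
    fix i assume "i < dim_vec (((\<Sum>d<n. ?h (int d)) / ?W) \<cdot>\<^sub>v fourier_vec n q)"
    then have i: "i < n" by (simp add: dim)
    have "(?A *\<^sub>v fourier_vec n q) $ i = (\<Sum>j<n. ?A $$ (i, j) * fourier_vec n q $ j)"
      using i by (simp add: scalar_prod_def dim lessThan_atLeast0)
    also have "\<dots> = (\<Sum>j<n. ?e (int i) * (?h (int i - int j) / ?W))"
    proof (rule sum.cong)
      fix j assume "j \<in> {..<n}"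
      moreover have "?e (int j) = ?e (int i) * inverse (?e (int i - int j))"
        unfolding cis_inverse cis_mult
        by (rule arg_cong[of _ _ cis]) (simp add: algebra_simps diff_divide_distrib)
      ultimately show "?A $$ (i, j) * fourier_vec n q $ j = ?e (int i) * (?h (int i - int j) / ?W)"
        using i by (simp add: consensus_attention_index fourier_vec_index w_def del: cis_inverse)
    qed simp
    also have "\<dots> = ?e (int i) * ((\<Sum>j<n. ?h (int i - int j)) / ?W)"
      by (simp only: sum_distrib_left sum_divide_distrib)
    also have "(\<Sum>j<n. ?h (int i - int j)) = (\<Sum>d<n. ?h (int d))"
      unfolding w_def
      by (rule sum_periodic_reflect)
        (simp_all only: assms attention_weight_periodic cis_periodic)
    finally show "(?A *\<^sub>v fourier_vec n q) $ i = (((\<Sum>d<n. ?h (int d)) / ?W) \<cdot>\<^sub>v fourier_vec n q) $ i"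
      using i by (simp add: dim fourier_vec_index)
  qed (simp add: dim)
  \<comment> \<open>The first entry of every Fourier vector is \<open>1\<close>.\<close>
  moreover have "fourier_vec n q $ 0 \<noteq> 0\<^sub>v n $ 0"
    using assms(1) by (simp add: fourier_vec_index)
  then have "fourier_vec n q \<noteq> 0\<^sub>v n"
    by metis
  ultimately show ?thesis
    by (simp only: eigenvector_def carrier_vec_def mem_Collect_eq dim cis_inverse
        index_map_mat consensus_attention_dim simp_thms)
qed

section \<open>The spectrum of the consensus attention matrix\<close>

text \<open>
  The Bessel sums in numerator and denominator are both \<open>1/n\<close> times finite Fourier coefficients of
  the weights, so their quotient is the convolution eigenvalue.
\<close>
lemma consensus_attention_bessel_eigenvector:
  assumes "n > 0"
  shows "eigenvector (map_mat complex_of_real (consensus_attention n (2 * pi * of_int m / real n) \<beta>))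
    (fourier_vec n q)
    (complex_of_real ((\<Sum>\<^sub>\<infinity>k \<in> {k. [m * k = int q] (mod int n)}. bessel_I k \<beta>) /
          (\<Sum>\<^sub>\<infinity>k \<in> {k. [m * k = 0] (mod int n)}. bessel_I k \<beta>)))"
proof -
  let ?w = "attention_weight \<beta> n m"
  have "complex_of_real ((\<Sum>\<^sub>\<infinity>k \<in> {k. [m * k = int q] (mod int n)}. bessel_I k \<beta>) /
          (\<Sum>\<^sub>\<infinity>k \<in> {k. [m * k = 0] (mod int n)}. bessel_I k \<beta>))
      = (\<Sum>d<n. of_real (?w (int d)) * cis (- (2 * pi * of_int (int q) * of_int (int d) / real n)))
        / of_real (\<Sum>d<n. ?w (int d))"
    unfolding of_real_divide bessel_I_residue_class_infsum[OF assms]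
      bessel_I_residue_class_infsum_0[OF assms]
    using assms by (simp add: attention_weight_def)
  then show ?thesis
    using consensus_attention_fourier_eigenvector[OF assms, of m \<beta> q] by (simp only:)
qed

lemma card_multiples_below:
  fixes g n :: nat
  assumes "g > 0" "g dvd n"
  shows "card {q. q < n \<and> g dvd q} = n div g"
proof -
  have "bij_betw (\<lambda>c. g * c) {..<n div g} {q. q < n \<and> g dvd q}"
    by (rule bij_betwI[where g = "\<lambda>q. q div g"]) (use assms in \<open>auto elim!: dvdE\<close>)
  then show ?thesis
    using bij_betw_same_card by fastforce
qed

theorem theorem5p1:
  fixes n g L :: nat and m :: int and \<omega> \<beta> :: real and A :: "real mat"
  assumes "n \<ge> 2"
    and "\<omega> = 2 * pi * of_int m / real n"
    and "g = nat (gcd m (int n))"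
    and "L = n div g"
    and "0 \<le> \<beta>"
    and "A = consensus_attention n \<omega> \<beta>"
  shows "symmetric_matrix A \<and> doubly_stochastic A \<and> circulant A \<and>
    (\<forall>q < n. (\<lambda>k. bessel_I k \<beta>) summable_on {k. [m * k = int q] (mod int n)}) \<and>
    (\<Sum>\<^sub>\<infinity>k \<in> {k. [m * k = 0] (mod int n)}. bessel_I k \<beta>) \<noteq> 0 \<and>
    (\<exists>lam :: nat \<Rightarrow> real.
       (\<forall>q < n. eigenvector (map_mat complex_of_real A) (fourier_vec n q) (complex_of_real (lam q))) \<and>
       (\<forall>q < n. lam q =
          (\<Sum>\<^sub>\<infinity>k \<in> {k. [m * k = int q] (mod int n)}. bessel_I k \<beta>) /
          (\<Sum>\<^sub>\<infinity>k \<in> {k. [m * k = 0] (mod int n)}. bessel_I k \<beta>)) \<and>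
       (\<forall>q < n. \<not> g dvd q \<longrightarrow> lam q = 0) \<and>
       (\<beta> > 0 \<longrightarrow> card {q. q < n \<and> lam q > 0} = L \<and> card {q. q < n \<and> lam q = 0} = n - L) \<and>
       (\<beta> = 0 \<longrightarrow> map lam [0..<n] = 1 # replicate (n - 1) 0))"
proof -
  let ?S = "\<lambda>q. \<Sum>\<^sub>\<infinity>k \<in> {k. [m * k = q] (mod int n)}. bessel_I k \<beta>"
  define lam where "lam q = ?S (int q) / ?S 0" for q :: nat
  have n: "n > 0" using assms(1) by simp
  have A: "A = consensus_attention n (2 * pi * of_int m / real n) \<beta>"
    using assms by simp
  have g: "int g = gcd m (int n)" "g > 0" "g dvd n"
    using n assms(3) by (auto simp flip: int_dvd_int_iff)
  \<comment> \<open>The denominator is an average of exponentials, hence positive also at \<open>\<beta> = 0\<close>.\<close>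
  have S0: "?S 0 > 0"
    unfolding bessel_I_residue_class_infsum_0[OF n] using n by (intro divide_pos_pos sum_pos) auto
  have vanish: "lam q = 0" if "\<not> g dvd q" for q
  proof -
    have "\<not> gcd m (int n) dvd int q"
      using that by (simp flip: g(1))
    then show ?thesis
      by (simp add: lam_def residue_class_empty)
  qed
  have pos: "lam q > 0" if "\<beta> > 0" "g dvd q" for q
    unfolding lam_def
    by (intro divide_pos_pos S0 bessel_I_residue_class_pos n that(1)) (use that(2) in \<open>simp flip: g(1)\<close>)
  have counts: "card {q. q < n \<and> lam q > 0} = L \<and> card {q. q < n \<and> lam q = 0} = n - L" if "\<beta> > 0"
  proof -
    have sign: "lam q > 0 \<longleftrightarrow> g dvd q" "lam q = 0 \<longleftrightarrow> \<not> g dvd q" for q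
      using pos[OF that, of q] vanish[of q] by (cases "g dvd q"; simp)+
    have "card {q. q < n \<and> g dvd q} = L"
      using card_multiples_below[OF g(2,3)] assms(4) by simp
    moreover have "{q. q < n \<and> \<not> g dvd q} = {..<n} - {q. q < n \<and> g dvd q}"
      by auto
    then have "card {q. q < n \<and> \<not> g dvd q} = n - card {q. q < n \<and> g dvd q}"
      by (simp add: card_Diff_subset subset_eq)
    ultimately show ?thesis
      by (simp add: sign)
  qed
  have zero: "map lam [0..<n] = 1 # replicate (n - 1) 0" if "\<beta> = 0"
  proof (rule nth_equalityI)
    show "length (map lam [0..<n]) = length (1 # replicate (n - 1) (0 :: real))"
      using n by simp
    fix q assume "q < length (map lam [0..<n])"
    moreover from this have "int n dvd int q \<longleftrightarrow> q = 0"
      by (auto dest: dvd_imp_le)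
    ultimately show "map lam [0..<n] ! q = (1 # replicate (n - 1) 0) ! q"
      using that by (simp add: lam_def bessel_I_residue_class_at_0 nth_Cons')
  qed
  show ?thesis
    unfolding A
    using S0 vanish counts zero
    by (intro conjI exI[of _ lam] consensus_attention_symmetric
        consensus_attention_doubly_stochastic consensus_attention_circulant)
      (auto simp: lam_def intro: bessel_I_residue_class_summable[OF n]
        consensus_attention_bessel_eigenvector[OF n] simp del: of_real_divide)
qed

end
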